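(* If $n$ is a positive integer divisible by $4$, then $\mathrm{ex}^*(n, C_3, P_3) = n$.
   Context: An edge-coloring is proper if any two edges sharing a vertex receive different colors. An edge-colored subgraph is rainbow if no two of its edges have the same color. $P_3$ denotes the path with $3$ edges and $C_3$ the triangle. $\mathrm{ex}^*(n,H,F)$ is the maximum number of rainbow copies of $H$ (as subgraphs) in an $n$-vertex simple graph with a proper edge-coloring containing no rainbow copy of $F$. *)

theory Defs
  imports Main
begin

type_synonym 'a ugraph = "'a set \<times> 'a set set"

abbreviation verts :: "'a ugraph \<Rightarrow> 'a set" where
  "verts G \<equiv> fst G"

abbreviation edges :: "'a ugraph \<Rightarrow> 'a set set" where
  "edges G \<equiv> snd G"

definition simple_graph :: "'a ugraph \<Rightarrow> bool" where
  "simple_graph G \<longleftrightarrow> finite (verts G) \<and> (\<forall>e\<in>edges G. e \<subseteq> verts G \<and> card e = 2)"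

definition subgraph :: "'a ugraph \<Rightarrow> 'a ugraph \<Rightarrow> bool" where
  "subgraph S G \<longleftrightarrow> simple_graph S \<and> verts S \<subseteq> verts G \<and> edges S \<subseteq> edges G"

definition graph_isomorphic :: "'a ugraph \<Rightarrow> 'b ugraph \<Rightarrow> bool" where
  "graph_isomorphic G H \<longleftrightarrow>
     (\<exists>f. bij_betw f (verts G) (verts H) \<and>
          (\<forall>u\<in>verts G. \<forall>v\<in>verts G. {u, v} \<in> edges G \<longleftrightarrow> {f u, f v} \<in> edges H))"

text \<open>The path with k edges, on k + 1 vertices.\<close>

definition path_graph :: "nat \<Rightarrow> nat ugraph" where
  "path_graph k = ({0..k}, {{i, Suc i} | i. i < k})"

text \<open>The cycle of length k; a simple graph of the intended kind only for k at least 3.\<close>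

definition cycle_graph :: "nat \<Rightarrow> nat ugraph" where
  "cycle_graph k = ({0..<k}, {{i, Suc i mod k} | i. i < k})"

definition proper_edge_coloring :: "'a ugraph \<Rightarrow> ('a set \<Rightarrow> 'c) \<Rightarrow> bool" where
  "proper_edge_coloring G c \<longleftrightarrow>
     (\<forall>e\<in>edges G. \<forall>f\<in>edges G. e \<noteq> f \<and> e \<inter> f \<noteq> {} \<longrightarrow> c e \<noteq> c f)"

definition rainbow :: "('a set \<Rightarrow> 'c) \<Rightarrow> 'a ugraph \<Rightarrow> bool" where
  "rainbow c S \<longleftrightarrow> inj_on c (edges S)"

definition rainbow_copies :: "'a ugraph \<Rightarrow> ('a set \<Rightarrow> 'c) \<Rightarrow> 'b ugraph \<Rightarrow> 'a ugraph set" where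
  "rainbow_copies G c H = {S. subgraph S G \<and> graph_isomorphic H S \<and> rainbow c S}"

text \<open>
  All numbers of rainbow copies of H that occur in a properly edge-colored n-vertex graph
  without a rainbow copy of F. Since the graphs are finite, natural numbers as vertices and as
  colors lose no generality; every number of colors is allowed.
\<close>

definition rainbow_copy_counts :: "nat \<Rightarrow> 'a ugraph \<Rightarrow> 'b ugraph \<Rightarrow> nat set" where
  "rainbow_copy_counts n H F =
     {card (rainbow_copies G c H) | (G :: nat ugraph) (c :: nat set \<Rightarrow> nat).
        simple_graph G \<and> card (verts G) = n \<and> proper_edge_coloring G c \<and>
        rainbow_copies G c F = {}}"

definition ex_star :: "nat \<Rightarrow> 'a ugraph \<Rightarrow> 'b ugraph \<Rightarrow> nat" where
  "ex_star n H F = Max (rainbow_copy_counts n H F)"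

text \<open>
  The maximum is over a finite set. The set is also nonempty as soon as F has an edge, because
  of the graph without edges, so for such F the maximum is attained.
\<close>

lemma finite_rainbow_copy_counts: "finite (rainbow_copy_counts n H F)"
proof -
  have "card (rainbow_copies G c H) \<le> 2 ^ n * 2 ^ 2 ^ n"
    if G: "simple_graph G" "card (verts G) = n" for G :: "nat ugraph" and c :: "nat set \<Rightarrow> nat"
  proof -
    have fin: "finite (verts G)" using G by (simp add: simple_graph_def)
    have "rainbow_copies G c H \<subseteq> Pow (verts G) \<times> Pow (Pow (verts G))"
      using G(1) unfolding rainbow_copies_def subgraph_def simple_graph_def by fastforce
    then have "card (rainbow_copies G c H) \<le> card (Pow (verts G) \<times> Pow (Pow (verts G)))"
      using fin by (intro card_mono) auto
    then show ?thesis using fin G(2) by (simp add: card_cartesian_product card_Pow)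
  qed
  then have "rainbow_copy_counts n H F \<subseteq> {..2 ^ n * 2 ^ 2 ^ n}"
    unfolding rainbow_copy_counts_def by auto
  then show ?thesis by (rule finite_subset) simp
qed

lemma rainbow_copy_counts_nonempty:
  assumes "simple_graph F" "edges F \<noteq> {}"
  shows "rainbow_copy_counts n H F \<noteq> {}"
proof -
  let ?G = "({0..<n}, {}) :: nat ugraph"
  obtain u v where uv: "{u, v} \<in> edges F" "u \<in> verts F" "v \<in> verts F"
    using assms unfolding simple_graph_def by (metis card_2_iff equals0I insert_subset)
  have "rainbow_copies ?G c F = {}" for c :: "nat set \<Rightarrow> nat"
    using uv unfolding rainbow_copies_def subgraph_def graph_isomorphic_def by fastforce
  moreover have "simple_graph ?G" "card (verts ?G) = n" "proper_edge_coloring ?G c"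
    for c :: "nat set \<Rightarrow> nat"
    by (auto simp: simple_graph_def proper_edge_coloring_def)
  ultimately show ?thesis unfolding rainbow_copy_counts_def by blast
qed

end

theory Submission
  imports Defs
begin

text \<open>
  In a proper coloring every triangle is rainbow. For the upper bound let v a b be a triangle.
  A further edge v x extends v a b to the path x v a b, which is not rainbow only if v x has the
  color of a b; so there is at most one such edge, v has degree at most 3, and v lies in at most
  3 triangles. Counting incidences of vertices and triangles gives at most n triangles.
  Disjoint copies of the complete graph on 4 vertices, each colored by its three perfect
  matchings, attain the bound, since the end edges of any path with 3 edges form a matching.
\<close>

section \<open>Triangles and 3-edge paths as concrete subgraphs\<close>

text \<open>Edges of simple graphs are doubletons of vertices, so a condition on all vertex pairs
  determines the whole edge set. This form lets a copy of the path be read off as an explicit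
  image.\<close>

lemma graph_isomorphic_iff_image:
  assumes G: "simple_graph G" and S: "simple_graph S"
  shows "graph_isomorphic G S \<longleftrightarrow>
    (\<exists>f. inj_on f (verts G) \<and> S = (f ` verts G, (`) f ` edges G))"
proof
  assume "graph_isomorphic G S"
  then obtain f where f: "bij_betw f (verts G) (verts S)"
    and e: "\<And>u v. u \<in> verts G \<Longrightarrow> v \<in> verts G \<Longrightarrow> {u, v} \<in> edges G \<longleftrightarrow> {f u, f v} \<in> edges S"
    unfolding graph_isomorphic_def by blast
  have V: "f ` verts G = verts S" using f by (simp add: bij_betw_def)
  have "edges S \<subseteq> (`) f ` edges G"
  proof
    fix p assume p: "p \<in> edges S"
    then obtain x y where xy: "p = {x, y}" "x \<in> verts S" "y \<in> verts S"
      using S unfolding simple_graph_def by (metis card_2_iff insert_subset)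
    then obtain u v where "u \<in> verts G" "v \<in> verts G" "x = f u" "y = f v"
      using V by blast
    then show "p \<in> (`) f ` edges G" using e p xy by (intro image_eqI[of _ _ "{u, v}"]) auto
  qed
  moreover have "(`) f ` edges G \<subseteq> edges S"
  proof clarify
    fix p assume p: "p \<in> edges G"
    then obtain x y where "p = {x, y}" "x \<in> verts G" "y \<in> verts G"
      using G unfolding simple_graph_def by (metis card_2_iff insert_subset)
    then show "f ` p \<in> edges S" using e p by auto
  qed
  ultimately have "S = (f ` verts G, (`) f ` edges G)" using V by (auto simp: prod_eq_iff)
  then show "\<exists>f. inj_on f (verts G) \<and> S = (f ` verts G, (`) f ` edges G)"
    using f by (auto simp: bij_betw_def)
next
  assume "\<exists>f. inj_on f (verts G) \<and> S = (f ` verts G, (`) f ` edges G)"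
  then obtain f where f: "inj_on f (verts G)" and S_eq: "S = (f ` verts G, (`) f ` edges G)"
    by blast
  have "{u, v} \<in> edges G \<longleftrightarrow> {f u, f v} \<in> edges S" if uv: "u \<in> verts G" "v \<in> verts G" for u v
  proof
    assume "{f u, f v} \<in> edges S"
    then obtain p where p: "p \<in> edges G" "f ` p = f ` {u, v}" using S_eq by auto
    have "p \<subseteq> verts G" using p G by (auto simp: simple_graph_def)
    \<comment> \<open>Taking images under \<open>f\<close> is injective on subsets of
      \<open>verts G\<close>, so no non-edge can be mapped onto an edge.\<close>
    then have "p = {u, v}" using inj_on_image_eq_iff[OF f, of p "{u, v}"] p(2) uv by simp
    then show "{u, v} \<in> edges G" using p by simp
  next
    assume "{u, v} \<in> edges G"
    then show "{f u, f v} \<in> edges S" using S_eq by (auto intro!: image_eqI[of _ _ "{u, v}"])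
  qed
  then show "graph_isomorphic G S"
    using f S_eq unfolding graph_isomorphic_def by (intro exI[of _ f]) (auto simp: bij_betw_def)
qed

text \<open>The edge set of the complete graph on \<open>A\<close>. A triangle is thus fixed by its
  vertex set.\<close>

definition pairs :: "'a set \<Rightarrow> 'a set set" where
  "pairs A = {e. e \<subseteq> A \<and> card e = 2}"

lemma doubleton_in_pairs [simp]: "{a, b} \<in> pairs A \<longleftrightarrow> a \<in> A \<and> b \<in> A \<and> a \<noteq> b"
  by (auto simp: pairs_def card_2_iff doubleton_eq_iff)

lemma pairs_doubletonE:
  assumes "e \<in> pairs A"
  obtains a b where "e = {a, b}" "a \<in> A" "b \<in> A" "a \<noteq> b"
  using assms by (auto simp: pairs_def card_2_iff)

lemma cycle_graph_3: "cycle_graph 3 = ({0..<3}, pairs {0..<3})"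
proof -
  have nat3: "i < 3 \<longleftrightarrow> i = 0 \<or> i = 1 \<or> i = 2" for i :: nat by auto
  have "{{i, Suc i mod 3} | i. i < 3} = {{0, 1}, {1, 2}, {2, 0::nat}}"
    by (auto simp: nat3)
  also have "\<dots> = pairs {0..<3}"
    by (auto elim!: pairs_doubletonE simp: nat3)
  finally show ?thesis by (simp add: cycle_graph_def)
qed

lemma path_graph_3: "path_graph 3 = ({0, 1, 2, 3}, {{0, 1}, {1, 2}, {2, 3}})"
proof -
  have "{i. i < 3} = {0, 1, 2::nat}" by auto
  then have "{{i, Suc i} | i. i < 3} = {{0, 1}, {1, 2}, {2, 3::nat}}"
    by (simp add: setcompr_eq_image numeral_eq_Suc)
  moreover have "{0..3} = {0, 1, 2, 3::nat}" by auto
  ultimately show ?thesis by (simp add: path_graph_def)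
qed

text \<open>The triangle is complete, so every bijection onto the vertices of another complete graph
  is an isomorphism and only the number of vertices matters.\<close>

lemma graph_isomorphic_cycle_3:
  assumes "simple_graph S"
  shows "graph_isomorphic (cycle_graph 3) S \<longleftrightarrow> card (verts S) = 3 \<and> edges S = pairs (verts S)"
proof
  assume "graph_isomorphic (cycle_graph 3) S"
  then obtain f where f: "bij_betw f {0..<3::nat} (verts S)"
    and e: "\<And>u v. u < 3 \<Longrightarrow> v < 3 \<Longrightarrow> u \<noteq> v \<longleftrightarrow> {f u, f v} \<in> edges S"
    unfolding graph_isomorphic_def cycle_graph_3 by auto
  have "pairs (verts S) \<subseteq> edges S"
  proof
    fix p assume "p \<in> pairs (verts S)"
    then obtain a b where ab: "p = {a, b}" "a \<in> verts S" "b \<in> verts S" "a \<noteq> b"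
      by (rule pairs_doubletonE)
    then have "a \<in> f ` {0..<3}" "b \<in> f ` {0..<3}" using f by (simp_all add: bij_betw_def)
    then obtain u v where "u < 3" "v < 3" "a = f u" "b = f v" by auto
    then show "p \<in> edges S" using e ab by blast
  qed
  moreover have "edges S \<subseteq> pairs (verts S)"
    using assms by (auto simp: simple_graph_def pairs_def)
  moreover have "card (verts S) = 3" using bij_betw_same_card[OF f] by simp
  ultimately show "card (verts S) = 3 \<and> edges S = pairs (verts S)" by blast
next
  assume S: "card (verts S) = 3 \<and> edges S = pairs (verts S)"
  then obtain f where f: "bij_betw f {0..<3::nat} (verts S)"
    using ex_bij_betw_nat_finite[of "verts S"] assms by (auto simp: simple_graph_def)
  then show "graph_isomorphic (cycle_graph 3) S"
    unfolding graph_isomorphic_def cycle_graph_3 using S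
    by (intro exI[of _ f]) (auto simp: bij_betw_def inj_on_eq_iff)
qed

lemma graph_isomorphic_path_3:
  assumes "simple_graph S"
  shows "graph_isomorphic (path_graph 3) S \<longleftrightarrow>
    (\<exists>w x y z. distinct [w, x, y, z] \<and> S = ({w, x, y, z}, {{w, x}, {x, y}, {y, z}}))"
proof -
  have P: "simple_graph (path_graph 3)"
    by (simp add: path_graph_3 simple_graph_def)
  show ?thesis
    unfolding graph_isomorphic_iff_image[OF P assms]
  proof
    assume "\<exists>f. inj_on f (verts (path_graph 3)) \<and>
      S = (f ` verts (path_graph 3), (`) f ` edges (path_graph 3))"
    then obtain f where "inj_on f {0, 1, 2, 3::nat}"
      "S = (f ` {0, 1, 2, 3}, (`) f ` {{0, 1}, {1, 2}, {2, 3}})"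
      by (auto simp: path_graph_3)
    then show "\<exists>w x y z. distinct [w, x, y, z] \<and> S = ({w, x, y, z}, {{w, x}, {x, y}, {y, z}})"
      by (intro exI[of _ "f 0"] exI[of _ "f 1"] exI[of _ "f 2"] exI[of _ "f 3"])
        (auto simp: inj_on_def)
  next
    assume "\<exists>w x y z. distinct [w, x, y, z] \<and> S = ({w, x, y, z}, {{w, x}, {x, y}, {y, z}})"
    then obtain w x y z where "distinct [w, x, y, z]"
      "S = ({w, x, y, z}, {{w, x}, {x, y}, {y, z}})" by blast
    then show "\<exists>f. inj_on f (verts (path_graph 3)) \<and>
      S = (f ` verts (path_graph 3), (`) f ` edges (path_graph 3))"
      by (intro exI[of _ "(!) [w, x, y, z]"]) (auto simp: path_graph_3 inj_on_def)
  qed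
qed

text \<open>Any two edges of a triangle share a vertex, so properness alone makes it rainbow.
  Counting rainbow copies becomes counting 3-sets of vertices.\<close>

lemma rainbow_copies_cycle_3:
  assumes "simple_graph G" "proper_edge_coloring G c"
  shows "rainbow_copies G c (cycle_graph 3) =
    {(T, pairs T) | T. T \<subseteq> verts G \<and> card T = 3 \<and> pairs T \<subseteq> edges G}" (is "_ = ?R")
proof
  show "rainbow_copies G c (cycle_graph 3) \<subseteq> ?R"
    by (force simp: rainbow_copies_def subgraph_def graph_isomorphic_cycle_3)
  show "?R \<subseteq> rainbow_copies G c (cycle_graph 3)"
  proof clarify
    fix T assume T: "T \<subseteq> verts G" "card T = 3" "pairs T \<subseteq> edges G"
    have fin: "finite T" using T(2) by (intro card_ge_0_finite) simp
    \<comment> \<open>Two disjoint pairs would need four elements of \<open>T\<close>.\<close>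
    have meet: "e \<inter> f \<noteq> {}" if "e \<in> pairs T" "f \<in> pairs T" for e f
    proof
      assume "e \<inter> f = {}"
      moreover have "finite e" "finite f" "e \<union> f \<subseteq> T" "card e = 2" "card f = 2"
        using that fin by (auto simp: pairs_def intro: finite_subset)
      ultimately show False
        using T(2) fin card_mono[of T "e \<union> f"] by (simp add: card_Un_disjoint)
    qed
    have simple: "simple_graph (T, pairs T)" using fin by (auto simp: simple_graph_def pairs_def)
    have "inj_on c (pairs T)"
      using assms(2) T(3) meet unfolding proper_edge_coloring_def inj_on_def by (meson subsetD)
    then show "(T, pairs T) \<in> rainbow_copies G c (cycle_graph 3)"
      using simple T
      by (simp add: rainbow_copies_def subgraph_def rainbow_def graph_isomorphic_cycle_3)
  qed
qed

text \<open>The form in which the absence of rainbow paths is applied: four distinct vertices joined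
  in a row span a copy of the path, so two of its three edges must agree in color.\<close>

lemma no_rainbow_path_3D:
  assumes "simple_graph G" "rainbow_copies G c (path_graph 3) = {}"
    and "distinct [w, x, y, z]" "{w, x} \<in> edges G" "{x, y} \<in> edges G" "{y, z} \<in> edges G"
  shows "c {w, x} = c {x, y} \<or> c {x, y} = c {y, z} \<or> c {w, x} = c {y, z}"
proof (rule ccontr)
  assume col: "\<not> ?thesis"
  let ?S = "({w, x, y, z}, {{w, x}, {x, y}, {y, z}})"
  have "simple_graph ?S" using assms(3) by (simp add: simple_graph_def)
  moreover have "{w, x} \<subseteq> verts G" "{y, z} \<subseteq> verts G"
    using assms(1,4,6) by (auto simp: simple_graph_def)
  ultimately have "subgraph ?S G" "graph_isomorphic (path_graph 3) ?S"
    using assms(3-) by (auto simp: subgraph_def graph_isomorphic_path_3)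
  moreover have "rainbow c ?S" using col by (auto simp: rainbow_def inj_on_def)
  ultimately show False using assms(2) by (auto simp: rainbow_copies_def)
qed

section \<open>Upper bound by double counting\<close>

lemma degree_of_triangle_vertex:
  assumes G: "simple_graph G" "proper_edge_coloring G c" "rainbow_copies G c (path_graph 3) = {}"
    and T: "{v, a} \<in> edges G" "{v, b} \<in> edges G" "{a, b} \<in> edges G"
  shows "card {x. {v, x} \<in> edges G} \<le> 3"
proof -
  let ?X = "{x. {v, x} \<in> edges G} - {a, b}"
  have loop: "{x, x} \<notin> edges G" for x using G(1) by (auto simp: simple_graph_def)
  have ne: "v \<noteq> a" "v \<noteq> b" "a \<noteq> b" using T loop by auto
  have proper: "c e \<noteq> c f" if "e \<in> edges G" "f \<in> edges G" "e \<noteq> f" "e \<inter> f \<noteq> {}" for e f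
    using G(2) that unfolding proper_edge_coloring_def by blast
  \<comment> \<open>In the path \<open>x\<close>, \<open>v\<close>, \<open>a\<close>,
    \<open>b\<close> properness separates consecutive edges, so only the two end edges can
    agree.\<close>
  have col: "c {v, x} = c {a, b}" if x: "x \<in> ?X" for x
  proof -
    have xv: "x \<noteq> v" "x \<noteq> a" "x \<noteq> b" "{x, v} \<in> edges G"
      using x loop by (auto simp: insert_commute)
    have "c {x, v} \<noteq> c {v, a}" "c {v, a} \<noteq> c {a, b}"
      using xv ne T by (simp_all add: proper doubleton_eq_iff)
    moreover have "c {x, v} = c {v, a} \<or> c {v, a} = c {a, b} \<or> c {x, v} = c {a, b}"
      using xv ne T by (intro no_rainbow_path_3D[OF G(1,3)]) auto
    ultimately show ?thesis by (simp add: insert_commute)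
  qed
  \<comment> \<open>All edges from \<open>v\<close> into \<open>?X\<close> have the color of
    \<open>{a, b}\<close>, which properness at \<open>v\<close> allows only once.\<close>
  have "x = y" if "x \<in> ?X" "y \<in> ?X" for x y
    using col[OF that(1)] col[OF that(2)] proper[of "{v, x}" "{v, y}"] that
    by (auto simp: doubleton_eq_iff)
  \<comment> \<open>If \<open>?X\<close> were infinite, its \<open>card\<close> would be 0 by
    convention, which also satisfies the bound.\<close>
  then have "card ?X \<le> 1" by (metis card_le_Suc0_iff_eq One_nat_def card.infinite zero_le)
  moreover have "card {x. {v, x} \<in> edges G} - card {a, b} \<le> card ?X"
    by (rule diff_card_le_card_Diff) simp
  ultimately show ?thesis using ne by simp
qed

lemma card_rainbow_triangles_le:
  assumes G: "simple_graph G" "proper_edge_coloring G c" "rainbow_copies G c (path_graph 3) = {}"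
  shows "card (rainbow_copies G c (cycle_graph 3)) \<le> card (verts G)"
proof -
  let ?T = "{T. T \<subseteq> verts G \<and> card T = 3 \<and> pairs T \<subseteq> edges G}"
  have fin: "finite (verts G)" using G(1) by (simp add: simple_graph_def)
  then have finT: "finite ?T" by simp
  have through: "card {T \<in> ?T. v \<in> T} \<le> 3" for v
  \<comment> \<open>The degree bound speaks of vertices of triangles, so a vertex in no triangle is
    split off.\<close>
  proof (cases "{T \<in> ?T. v \<in> T} = {}")
    case False
    then obtain T where T: "card T = 3" "pairs T \<subseteq> edges G" "v \<in> T" by blast
    then have "card (T - {v}) = 2" by simp
    then obtain a b where "T - {v} = {a, b}" "a \<noteq> b" by (auto simp: card_2_iff)
    then have "a \<in> T" "b \<in> T" "v \<noteq> a" "v \<noteq> b" "a \<noteq> b" by auto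
    then have ab: "{v, a} \<in> edges G" "{v, b} \<in> edges G" "{a, b} \<in> edges G"
      using T by (auto intro!: subsetD[OF T(2)])
    let ?N = "{x. {v, x} \<in> edges G}"
    have "?N \<subseteq> verts G" using G(1) by (auto simp: simple_graph_def)
    then have finN: "finite ?N" using fin by (rule finite_subset)
    \<comment> \<open>A triangle through \<open>v\<close> is recovered from its opposite edge, a
      pair of neighbors of \<open>v\<close>.\<close>
    have "card {T \<in> ?T. v \<in> T} \<le> card (pairs ?N)"
    proof (rule card_inj_on_le)
      show "inj_on (\<lambda>T. T - {v}) {T \<in> ?T. v \<in> T}"
        by (rule inj_onI) (metis (no_types, lifting) insert_Diff mem_Collect_eq)
      show "(\<lambda>T. T - {v}) ` {T \<in> ?T. v \<in> T} \<subseteq> pairs ?N"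
      proof clarify
        fix T assume T: "card T = 3" "pairs T \<subseteq> edges G" "v \<in> T"
        have "{v, x} \<in> edges G" if "x \<in> T - {v}" for x
          using that T(3) by (intro subsetD[OF T(2)]) auto
        then show "T - {v} \<in> pairs ?N" using T by (auto simp: pairs_def)
      qed
      show "finite (pairs ?N)" using finN by (simp add: pairs_def)
    qed
    also have "\<dots> = card ?N choose 2" unfolding pairs_def using finN by (rule n_subsets)
    also have "\<dots> \<le> 3 choose 2"
      using degree_of_triangle_vertex[OF G ab] by (rule binomial_right_mono)
    also have "\<dots> = 3" by (simp add: numeral_eq_Suc)
    finally show ?thesis .
  qed (simp only: card.empty)
  \<comment> \<open>Incidences counted by triangles give exactly 3 each, counted by vertices at most
    3 each.\<close>
  have "3 * card ?T = (\<Sum>T\<in>?T. card T)" by simp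
  also have "\<dots> = (\<Sum>T\<in>?T. card {v \<in> verts G. v \<in> T})"
    by (intro sum.cong refl arg_cong[of _ _ card]) auto
  also have "\<dots> = (\<Sum>v\<in>verts G. card {T \<in> ?T. v \<in> T})"
    using finT fin by (intro sum_multicount_gen) auto
  also have "\<dots> \<le> (\<Sum>v\<in>verts G. 3)" by (intro sum_mono through)
  finally have "card ?T \<le> card (verts G)" by simp
  moreover have "rainbow_copies G c (cycle_graph 3) = (\<lambda>T. (T, pairs T)) ` ?T"
    using rainbow_copies_cycle_3[OF G(1,2)] by auto
  ultimately show ?thesis using card_image_le[OF finT, of "\<lambda>T. (T, pairs T)"] by simp
qed

section \<open>Extremal construction from complete graphs on four vertices\<close>

text \<open>The blocks are the runs of four consecutive numbers starting at multiples of 4, each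
  made complete. For \<open>4 dvd n\<close> all blocks are full.\<close>

definition block_graph :: "nat \<Rightarrow> nat ugraph" where
  "block_graph n = ({0..<n}, {{u, v} | u v. u < n \<and> v < n \<and> u \<noteq> v \<and> u div 4 = v div 4})"

text \<open>
  Two disjoint edges of a block have residue sums adding up to 0 + 1 + 2 + 3 = 6, so the
  color classes are the perfect matchings of the blocks.
\<close>

definition matching_color :: "nat set \<Rightarrow> nat" where
  "matching_color e = (let s = \<Sum>u\<in>e. u mod 4 in min s (6 - s))"

lemma doubleton_in_block_graph:
  "{u, v} \<in> edges (block_graph n) \<longleftrightarrow> u < n \<and> v < n \<and> u \<noteq> v \<and> u div 4 = v div 4"
  by (auto simp: block_graph_def doubleton_eq_iff)

lemma edge_block_graphE:
  assumes "e \<in> edges (block_graph n)"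
  obtains u v where "e = {u, v}" "u < n" "v < n" "u \<noteq> v" "u div 4 = v div 4"
  using assms by (auto simp: block_graph_def)

lemma simple_block_graph: "simple_graph (block_graph n)"
  by (auto simp: simple_graph_def block_graph_def)

text \<open>Within a block the residues serve as names of the vertices, which reduces questions
  about colors to residues.\<close>

lemma mod_neq_if_div_eq:
  fixes u v :: nat
  assumes "u \<noteq> v" "u div k = v div k"
  shows "u mod k \<noteq> v mod k"
  using assms by (metis div_mult_mod_eq)

lemma matching_color_doubleton:
  assumes "u \<noteq> v"
  shows "matching_color {u, v} = min (u mod 4 + v mod 4) (6 - (u mod 4 + v mod 4))"
  using assms by (simp add: matching_color_def Let_def)

text \<open>Equal values would mean \<open>q = r\<close> or \<open>p + q + (p + r) = 6\<close>. As
  the four residues add up to 6, the latter would make \<open>p\<close> equal to the residue missing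
  from \<open>p\<close>, \<open>q\<close>, \<open>r\<close>. The proof checks the finitely many
  cases.\<close>

lemma min_residue_sum_neq:
  fixes p q r :: nat
  assumes "p < 4" "q < 4" "r < 4" "p \<noteq> q" "p \<noteq> r" "q \<noteq> r"
  shows "min (p + q) (6 - (p + q)) \<noteq> min (p + r) (6 - (p + r))"
proof -
  have "k = 0 \<or> k = 1 \<or> k = 2 \<or> k = 3" if "k < 4" for k :: nat using that by auto
  from this[OF assms(1)] this[OF assms(2)] this[OF assms(3)] assms(4-)
  show ?thesis by (elim disjE) simp_all
qed

lemma proper_matching_color: "proper_edge_coloring (block_graph n) matching_color"
proof -
  have *: "matching_color {u, v} \<noteq> matching_color {u, w}"
    if "u \<noteq> v" "u \<noteq> w" "v \<noteq> w" "u div 4 = v div 4" "u div 4 = w div 4" for u v w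
    unfolding matching_color_doubleton[OF that(1)] matching_color_doubleton[OF that(2)]
    using that by (intro min_residue_sum_neq) (simp_all add: mod_neq_if_div_eq)
  show ?thesis
    unfolding proper_edge_coloring_def
  proof (intro ballI impI)
    fix e f assume e: "e \<in> edges (block_graph n)" and f: "f \<in> edges (block_graph n)"
      and "e \<noteq> f \<and> e \<inter> f \<noteq> {}"
    then obtain u where u: "u \<in> e" "u \<in> f" and "e \<noteq> f" by blast
    obtain v where v: "e = {u, v}" using e u by (elim edge_block_graphE) auto
    obtain w where w: "f = {u, w}" using f u by (elim edge_block_graphE) auto
    show "matching_color e \<noteq> matching_color f"
      using *[of u v w] e f \<open>e \<noteq> f\<close> unfolding v w by (auto simp: doubleton_in_block_graph)
  qed
qed

lemma no_rainbow_path_block_graph: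
  "rainbow_copies (block_graph n) matching_color (path_graph 3) = {}"
proof (rule equals0I)
  fix S assume "S \<in> rainbow_copies (block_graph n) matching_color (path_graph 3)"
  then have S: "simple_graph S" "edges S \<subseteq> edges (block_graph n)"
    "graph_isomorphic (path_graph 3) S" "inj_on matching_color (edges S)"
    by (auto simp: rainbow_copies_def subgraph_def rainbow_def)
  then obtain w x y z where d: "distinct [w, x, y, z]"
    and S_eq: "S = ({w, x, y, z}, {{w, x}, {x, y}, {y, z}})"
    by (auto simp: graph_isomorphic_path_3)
  \<comment> \<open>Edges stay inside a block, so the four vertices of the path fill one block and
    their residues are 0, 1, 2, 3.\<close>
  have div: "w div 4 = x div 4" "x div 4 = y div 4" "y div 4 = z div 4"
    using S(2) by (simp_all add: S_eq doubleton_in_block_graph)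
  have "w mod 4 \<noteq> x mod 4" "w mod 4 \<noteq> y mod 4" "w mod 4 \<noteq> z mod 4"
    "x mod 4 \<noteq> y mod 4" "x mod 4 \<noteq> z mod 4" "y mod 4 \<noteq> z mod 4"
    using d div by (simp_all add: mod_neq_if_div_eq)
  moreover have "w mod 4 < 4" "x mod 4 < 4" "y mod 4 < 4" "z mod 4 < 4" by auto
  ultimately have "w mod 4 + x mod 4 + (y mod 4 + z mod 4) = 6" by linarith
  \<comment> \<open>Passing from one end edge to the other swaps the two arguments of
    \<open>min\<close> in the color.\<close>
  then have "6 - (w mod 4 + x mod 4) = y mod 4 + z mod 4"
    "6 - (y mod 4 + z mod 4) = w mod 4 + x mod 4" by simp_all
  then have "matching_color {w, x} = matching_color {y, z}"
    using d by (simp add: matching_color_doubleton min.commute)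
  then have "{w, x} = {y, z}" by (rule inj_onD[OF S(4)]) (simp_all add: S_eq)
  then show False using d by (auto simp: doubleton_eq_iff)
qed

text \<open>Each vertex is assigned the triangle on the other three vertices of its block, and
  different vertices get different triangles.\<close>

lemma card_triangles_block_graph_ge:
  assumes "4 dvd n"
  shows "n \<le> card (rainbow_copies (block_graph n) matching_color (cycle_graph 3))"
proof -
  let ?B = "\<lambda>x::nat. {y. y div 4 = x div 4}"
  let ?T = "\<lambda>x. ?B x - {x}"
  have B: "?B x = {4 * (x div 4)..<4 * (x div 4) + 4}" for x by auto
  have cardT: "card (?T x) = 3" for x
  proof -
    have "card (?B x) = 4" unfolding B by simp
    then show ?thesis by simp
  qed
  \<comment> \<open>Divisibility enters here: for \<open>n = 4 * k\<close>, being below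
    \<open>n\<close> depends only on the block, namely on whether its index is below
    \<open>k\<close>.\<close>
  have less: "y < n" if "y div 4 = x div 4" "x < n" for x y
    using assms that by (auto simp flip: div_less_iff_less_mult simp: dvd_def mult.commute)
  have "card {0..<n} \<le> card (rainbow_copies (block_graph n) matching_color (cycle_graph 3))"
  proof (rule card_inj_on_le)
    show "inj_on (\<lambda>x. (?T x, pairs (?T x))) {0..<n}"
    proof (rule inj_onI)
      fix x y assume "(?T x, pairs (?T x)) = (?T y, pairs (?T y))"
      then have eq: "?T x = ?T y" by simp
      \<comment> \<open>A common element puts \<open>x\<close> and \<open>y\<close> in the same
        block; if they differed, \<open>y\<close> would lie in \<open>?T x\<close> but not in
        \<open>?T y\<close>.\<close>
      moreover have "?T x \<noteq> {}" using cardT[of x] by (metis card.empty zero_neq_numeral)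
      ultimately obtain z where "z \<in> ?T x" "z \<in> ?T y" by blast
      then have "y \<in> ?B x" by simp
      then show "x = y" using eq by blast
    qed
    show "(\<lambda>x. (?T x, pairs (?T x))) ` {0..<n}
      \<subseteq> rainbow_copies (block_graph n) matching_color (cycle_graph 3)"
      unfolding rainbow_copies_cycle_3[OF simple_block_graph proper_matching_color]
    proof (rule image_subsetI)
      fix x assume x: "x \<in> {0..<n}"
      have "?T x \<subseteq> verts (block_graph n)" using x by (auto simp: block_graph_def intro: less[of _ x])
      moreover have "pairs (?T x) \<subseteq> edges (block_graph n)"
        using x by (auto elim!: pairs_doubletonE simp: doubleton_in_block_graph intro: less[of _ x])
      ultimately show "(?T x, pairs (?T x)) \<in> {(T, pairs T) | T.
          T \<subseteq> verts (block_graph n) \<and> card T = 3 \<and> pairs T \<subseteq> edges (block_graph n)}"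
        using cardT[of x] by blast
    qed
    show "finite (rainbow_copies (block_graph n) matching_color (cycle_graph 3))"
      unfolding rainbow_copies_cycle_3[OF simple_block_graph proper_matching_color]
      by (simp add: block_graph_def)
  qed
  then show ?thesis by simp
qed

theorem theorem8:
  fixes n :: nat
  assumes "n > 0" and "4 dvd n"
  shows "ex_star n (cycle_graph 3) (path_graph 3) = n"
  unfolding ex_star_def
proof (rule Max_eqI)
  show "finite (rainbow_copy_counts n (cycle_graph 3) (path_graph 3))"
    by (rule finite_rainbow_copy_counts)
  show "k \<le> n" if "k \<in> rainbow_copy_counts n (cycle_graph 3) (path_graph 3)" for k
    using that card_rainbow_triangles_le by (auto simp: rainbow_copy_counts_def)
  have n: "card (verts (block_graph n)) = n" by (simp add: block_graph_def)
  \<comment> \<open>The general upper bound, applied to the construction itself, turns its lower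
    bound into equality.\<close>
  have "card (rainbow_copies (block_graph n) matching_color (cycle_graph 3)) = n"
    using card_triangles_block_graph_ge[OF assms(2)] n
      card_rainbow_triangles_le[OF simple_block_graph[of n] proper_matching_color
        no_rainbow_path_block_graph]
    by simp
  then show "n \<in> rainbow_copy_counts n (cycle_graph 3) (path_graph 3)"
    unfolding rainbow_copy_counts_def
    using simple_block_graph n proper_matching_color no_rainbow_path_block_graph
    by (intro CollectI exI[of _ "block_graph n"] exI[of _ matching_color]) simp
qed

end
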